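(* Let $G$ be a strongly connected ribbon digraph. A divisor-and-rotor configuration $(x,\varrho)$ on $G$ is recurrent if and only if $x\geq 0$ (coordinatewise) and every directed cycle of the rotor subgraph of $\varrho$ contains at least one vertex $v$ with $x(v)>0$.
   Context: A digraph here is strongly connected, may have multiple edges, and has no loops. A ribbon digraph is a digraph together with, for each vertex $v$, a fixed cyclic ordering of the edges leaving $v$; for an edge $e$ leaving $v$, $e^+$ denotes the edge following $e$ in this cyclic order. A divisor is a vector $x\in\mathbb{Z}^{V(G)}$ (entries may be negative). A rotor configuration $\varrho$ assigns to each vertex $v$ an edge $\varrho(v)$ with tail $v$; the rotor subgraph is the subgraph with edge set $\{\varrho(v):v\in V(G)\}$. A divisor-and-rotor configuration (DRC) is a pair $(x,\varrho)$ of a divisor and a rotor configuration. Routing at a vertex $v$ transforms $(x,\varrho)$ into $(x',\varrho')$, where $\varrho'(v)=\varrho(v)^+$, $\varrho'(u)=\varrho(u)$ for $u\neq v$, and $x'=x-\mathbf{1}_v+\mathbf{1}_{v'}$ with $v'$ the head of $\varrho(v)^+$. The routing at $v$ is legal if $x(v)>0$. A legal game is a sequence of configurations each obtained from the previous one by a legal routing. A DRC is recurrent if there is a legal game consisting of at least one routing that starts at it and returns to it. *)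

theory Defs
  imports "Graph_Theory.Graph_Theory" "HOL-Combinatorics.Orbits"
begin

text \<open>
  The ribbon structure is the successor map \<open>nxt\<close>, written $e \mapsto e^+$ in the literature.
  Since \<open>cyclic_on\<close> entails non-emptiness, vertices without outgoing arcs are exempted.
\<close>

locale ribbon_digraph = fin_digraph G + loopfree_digraph G
  for G :: "('a, 'b) pre_digraph" +
  fixes nxt :: "'b \<Rightarrow> 'b"
  assumes cyclic_out_arcs:
    "\<lbrakk>v \<in> verts G; out_arcs G v \<noteq> {}\<rbrakk> \<Longrightarrow> cyclic_on nxt (out_arcs G v)"

type_synonym 'a divisor = "'a \<Rightarrow> int"

type_synonym ('a, 'b) drc = "'a divisor \<times> ('a \<Rightarrow> 'b)"

text \<open>
  Divisors and rotor configurations are functions on the whole vertex type; their values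
  outside \<open>verts G\<close> are irrelevant, and routing at a vertex of \<open>G\<close> leaves them unchanged.
\<close>

definition rotor_config :: "('a, 'b) pre_digraph \<Rightarrow> ('a \<Rightarrow> 'b) \<Rightarrow> bool" where
  "rotor_config G \<rho> \<longleftrightarrow> (\<forall>v \<in> verts G. \<rho> v \<in> out_arcs G v)"

definition rotor_subgraph ::
  "('a, 'b) pre_digraph \<Rightarrow> ('a \<Rightarrow> 'b) \<Rightarrow> ('a, 'b) pre_digraph" where
  "rotor_subgraph G \<rho> = G\<lparr>arcs := \<rho> ` verts G\<rparr>"

definition route ::
  "('a, 'b) pre_digraph \<Rightarrow> ('b \<Rightarrow> 'b) \<Rightarrow> 'a \<Rightarrow> ('a, 'b) drc \<Rightarrow> ('a, 'b) drc" where
  "route G nxt v c = (case c of (x, \<rho>) \<Rightarrow>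
     (\<lambda>u. x u - of_bool (u = v) + of_bool (u = head G (nxt (\<rho> v))), \<rho>(v := nxt (\<rho> v))))"

definition legal_routing ::
  "('a, 'b) pre_digraph \<Rightarrow> ('b \<Rightarrow> 'b) \<Rightarrow> ('a, 'b) drc \<Rightarrow> ('a, 'b) drc \<Rightarrow> bool" where
  "legal_routing G nxt c c' \<longleftrightarrow> (\<exists>v \<in> verts G. fst c v > 0 \<and> c' = route G nxt v c)"

definition recurrent ::
  "('a, 'b) pre_digraph \<Rightarrow> ('b \<Rightarrow> 'b) \<Rightarrow> ('a, 'b) drc \<Rightarrow> bool" where
  "recurrent G nxt c \<longleftrightarrow> (legal_routing G nxt)\<^sup>+\<^sup>+ c c"

end

theory Submission
  imports Defs
begin

text \<open>
  Call a nonempty vertex set closed if the rotors do not lead out of it; the minimal closed sets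
  are the rotor cycles, so the cycle condition says that every closed set carries a chip.

  In a game from a recurrent configuration back to itself every rotor performs full turns, so by
  strong connectivity every vertex is routed. The configuration is then nonnegative and every
  closed set carries a chip, because these properties hold at any time for the vertices routed so
  far: when \<open>v\<close> is routed, each closed set containing \<open>v\<close> receives the chip that leaves \<open>v\<close>.

  Conversely, a configuration with this property has a predecessor with the same property. Going
  backwards among the finitely many configurations with the given number of chips ends in a
  recurrent configuration, from which the given one is reached by a legal game. Recurrence is
  preserved by legal routings because routings at distinct vertices commute.
\<close>

section \<open>Finiteness preliminaries\<close>

lemma finite_funpow_periodic:
  assumes "finite A" "f ` A \<subseteq> A" "a \<in> A"
  obtains m n where "0 < n" "(f ^^ n) ((f ^^ m) a) = (f ^^ m) a"
proof -
  have "(f ^^ i) a \<in> A" for i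
    by (induction i) (use assms in auto)
  then have "finite (range (\<lambda>i. (f ^^ i) a))"
    using assms(1) by (auto intro: finite_subset)
  then have "\<not> inj (\<lambda>i. (f ^^ i) a)"
    using finite_imageD infinite_UNIV_nat by blast
  then obtain i j where "i < j" "(f ^^ i) a = (f ^^ j) a"
    using linorder_injI[of "\<lambda>i. (f ^^ i) a"] by blast
  moreover have "(f ^^ (j - i)) ((f ^^ i) a) = (f ^^ (j - i + i)) a"
    by (simp add: funpow_add)
  ultimately show thesis
    using that[of "j - i" i] by simp
qed

text \<open>Divisors and rotor configurations are total functions, so finiteness can be expected
  only after freezing the values outside \<open>A\<close> to those of \<open>h\<close>.\<close>

lemma finite_functions_fixed_outside:
  assumes "finite A" "\<And>a. a \<in> A \<Longrightarrow> finite (B a)"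
  shows "finite {f. (\<forall>a \<in> A. f a \<in> B a) \<and> (\<forall>a. a \<notin> A \<longrightarrow> f a = h a)}"
proof (rule finite_subset)
  show "finite ((\<lambda>f a. if a \<in> A then f a else h a) ` PiE A B)"
    using assms by (simp add: finite_PiE)
  show "{f. (\<forall>a \<in> A. f a \<in> B a) \<and> (\<forall>a. a \<notin> A \<longrightarrow> f a = h a)}
      \<subseteq> (\<lambda>f a. if a \<in> A then f a else h a) ` PiE A B"
  proof
    fix f assume "f \<in> {f. (\<forall>a \<in> A. f a \<in> B a) \<and> (\<forall>a. a \<notin> A \<longrightarrow> f a = h a)}"
    then show "f \<in> (\<lambda>f a. if a \<in> A then f a else h a) ` PiE A B"
      by (intro image_eqI[where x = "restrict f A"]) (auto simp: fun_eq_iff)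
  qed
qed

section \<open>Routings and legal games\<close>

lemma fst_route:
  "fst (route G nxt v c) u = fst c u - of_bool (u = v) + of_bool (u = head G (nxt (snd c v)))"
  by (cases c) (simp add: route_def)

lemma snd_route: "snd (route G nxt v c) = (snd c)(v := nxt (snd c v))"
  by (cases c) (simp add: route_def)

text \<open>The list keeps the order and the multiplicity of the routed vertices, which the
  transitive closure forgets: counting gives full rotor turns, reordering gives commutation.\<close>

fun legal_game ::
  "('a, 'b) pre_digraph \<Rightarrow> ('b \<Rightarrow> 'b) \<Rightarrow> 'a list \<Rightarrow> ('a, 'b) drc \<Rightarrow> ('a, 'b) drc \<Rightarrow> bool" where
  "legal_game G nxt [] c c' \<longleftrightarrow> c = c'"
| "legal_game G nxt (v # vs) c c' \<longleftrightarrow>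
     v \<in> verts G \<and> fst c v > 0 \<and> legal_game G nxt vs (route G nxt v c) c'"

lemma legal_game_append:
  "legal_game G nxt (vs @ ws) c c' \<longleftrightarrow>
     (\<exists>d. legal_game G nxt vs c d \<and> legal_game G nxt ws d c')"
  by (induction vs arbitrary: c) auto

lemma tranclp_legal_routing_iff:
  "(legal_routing G nxt)\<^sup>+\<^sup>+ c c' \<longleftrightarrow> (\<exists>vs. vs \<noteq> [] \<and> legal_game G nxt vs c c')"
proof
  assume "(legal_routing G nxt)\<^sup>+\<^sup>+ c c'"
  then show "\<exists>vs. vs \<noteq> [] \<and> legal_game G nxt vs c c'"
  proof (induction rule: tranclp_induct)
    case (base d)
    then obtain v where "legal_game G nxt [v] c d"
      by (auto simp: legal_routing_def)
    then show ?case by blast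
  next
    case (step d e)
    then obtain vs v where "legal_game G nxt vs c d" "legal_game G nxt [v] d e"
      by (auto simp: legal_routing_def)
    then have "legal_game G nxt (vs @ [v]) c e"
      unfolding legal_game_append by blast
    then show ?case by blast
  qed
next
  assume "\<exists>vs. vs \<noteq> [] \<and> legal_game G nxt vs c c'"
  then obtain vs where "vs \<noteq> []" "legal_game G nxt vs c c'" by blast
  then show "(legal_routing G nxt)\<^sup>+\<^sup>+ c c'"
  proof (induction vs arbitrary: c rule: list_nonempty_induct)
    case (single v)
    then show ?case by (auto simp: legal_routing_def)
  next
    case (cons v vs)
    then have "legal_routing G nxt c (route G nxt v c)"
      by (auto simp: legal_routing_def)
    moreover have "(legal_routing G nxt)\<^sup>+\<^sup>+ (route G nxt v c) c'"
      using cons by simp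
    ultimately show ?case by (rule tranclp_into_tranclp2)
  qed
qed

lemma recurrent_iff_legal_game:
  "recurrent G nxt c \<longleftrightarrow> (\<exists>vs. vs \<noteq> [] \<and> legal_game G nxt vs c c)"
  by (simp add: recurrent_def tranclp_legal_routing_iff)

lemma snd_legal_game:
  "legal_game G nxt vs c c' \<Longrightarrow> snd c' v = (nxt ^^ count_list vs v) (snd c v)"
proof (induction vs arbitrary: c)
  case (Cons u vs)
  then have "snd c' v = (nxt ^^ count_list vs v) (snd (route G nxt u c) v)" by simp
  then show ?case by (simp add: snd_route funpow_swap1)
qed simp

lemma unrouted_chips_mono:
  "legal_game G nxt vs c c' \<Longrightarrow> w \<notin> set vs \<Longrightarrow> fst c w \<le> fst c' w"
proof (induction vs arbitrary: c)
  case (Cons v vs)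
  then have "fst (route G nxt v c) w \<le> fst c' w" "w \<noteq> v" by auto
  then show ?case by (auto simp: fst_route of_bool_def split: if_splits)
qed simp

text \<open>The \<open>k\<close>-th routing at \<open>v\<close> sends a chip along
  \<open>(nxt ^^ k) (snd c v)\<close>, that is, to \<open>w\<close>, and \<open>w\<close>, never
  being routed, cannot lose it.\<close>

lemma unrouted_chips_less:
  assumes "legal_game G nxt vs c c'" "w \<notin> set vs"
    "0 < k" "k \<le> count_list vs v" "head G ((nxt ^^ k) (snd c v)) = w"
  shows "fst c w < fst c' w"
  using assms
proof (induction vs arbitrary: c k)
  case (Cons u vs)
  let ?c = "route G nxt u c"
  have game: "legal_game G nxt vs ?c c'" and w: "w \<notin> set vs" "w \<noteq> u"
    using Cons.prems by auto
  have step: "fst c w \<le> fst ?c w"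
    using w by (simp add: fst_route)
  show ?case
  proof (cases "u = v \<and> k = 1")
    case True
    then have "fst c w < fst ?c w"
      using Cons.prems w by (simp add: fst_route)
    also have "\<dots> \<le> fst c' w"
      using game w by (simp add: unrouted_chips_mono)
    finally show ?thesis .
  next
    case False
    have "fst ?c w < fst c' w"
    proof (cases "u = v")
      case True
      \<comment> \<open>The routing just made has advanced the rotor at \<open>v\<close> by one, so
        the awaited one is now the \<open>l\<close>-th.\<close>
      with False Cons.prems(3) obtain l where "k = Suc l" "0 < l"
        by (cases k) auto
      then show ?thesis
        using Cons.prems True by (intro Cons.IH[of _ l]) (auto simp: snd_route funpow_swap1)
    next
      case False
      then show ?thesis
        using Cons.prems by (intro Cons.IH[of _ k]) (auto simp: snd_route)
    qed
    with step show ?thesis by simp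
  qed
qed simp

lemma funpow_period_mult:
  assumes "(f ^^ k) a = a"
  shows "(f ^^ (k * m)) a = a"
  by (induction m) (simp_all add: assms funpow_add)

text \<open>Exponents run from 1 to \<open>k\<close> because a routing advances the rotor before
  sending the chip: the initial rotor arc is used only at the end of a full turn.\<close>

lemma orbit_in_period:
  assumes "(f ^^ k) a = a" "0 < k" "b \<in> orbit f a"
  obtains i where "0 < i" "i \<le> k" "b = (f ^^ i) a"
proof -
  obtain n where n: "b = (f ^^ n) a"
    using assms(3) by (auto simp: orbit_altdef)
  have b: "b = (f ^^ (n mod k)) a"
  proof -
    have "b = (f ^^ (n mod k + k * (n div k))) a"
      by (simp add: n)
    also have "\<dots> = (f ^^ (n mod k)) a"
      using funpow_period_mult[OF assms(1)] by (simp only: funpow_add o_apply)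
    finally show ?thesis .
  qed
  show thesis
  proof (cases "n mod k = 0")
    case True
    with b assms that[of k] show thesis by simp
  next
    case False
    with b assms that[of "n mod k"] show thesis by simp
  qed
qed

section \<open>Rotor-closed sets and the charge invariant\<close>

definition rotor_closed :: "('a, 'b) pre_digraph \<Rightarrow> ('a \<Rightarrow> 'b) \<Rightarrow> 'a set \<Rightarrow> bool" where
  "rotor_closed G \<rho> C \<longleftrightarrow> C \<noteq> {} \<and> (\<forall>v \<in> C. head G (\<rho> v) \<in> C)"

text \<open>
  The set \<open>S\<close> stands for the vertices routed so far; it makes the property inductive along a game.
\<close>
definition charged :: "('a, 'b) pre_digraph \<Rightarrow> 'a set \<Rightarrow> ('a, 'b) drc \<Rightarrow> bool" where
  "charged G S c \<longleftrightarrow> (\<forall>v \<in> S. 0 \<le> fst c v) \<and>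
     (\<forall>C \<subseteq> S. rotor_closed G (snd c) C \<longrightarrow> (\<exists>v \<in> C. 0 < fst c v))"

lemma (in pre_digraph) cas_head_in:
  "cas u p v \<Longrightarrow> e \<in> set p \<Longrightarrow> head G e \<in> insert v (tail G ` set p)"
proof (induction p arbitrary: u)
  case (Cons a p)
  then show ?case by (cases p) auto
qed simp

context ribbon_digraph
begin

lemma nxt_out_arcs:
  assumes "v \<in> verts G" "e \<in> out_arcs G v"
  shows "nxt e \<in> out_arcs G v"
  using cyclic_out_arcs assms by (metis cyclic_on_alldef empty_iff orbit.base)

text \<open>An arc lies in its own orbit under \<open>nxt\<close>; the last step of that orbit
  supplies the predecessor. This is what allows a rotor to be turned back.\<close>

lemma ex_prev_arc:
  assumes "v \<in> verts G" "e \<in> out_arcs G v"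
  obtains e' where "e' \<in> out_arcs G v" "nxt e' = e"
proof -
  have cyc: "cyclic_on nxt (out_arcs G v)"
    using cyclic_out_arcs assms by blast
  then have "e \<in> orbit nxt e"
    using assms(2) by (auto simp: cyclic_on_alldef)
  then show thesis
  proof cases
    case base
    with that assms show thesis by metis
  next
    case (step y)
    then show thesis using that cyc assms(2) by (metis cyclic_on_alldef)
  qed
qed

lemma rotor_config_route:
  assumes "rotor_config G (snd c)" "v \<in> verts G"
  shows "rotor_config G (snd (route G nxt v c))"
  using assms nxt_out_arcs by (auto simp: rotor_config_def snd_route)

lemma rotor_config_head:
  assumes "rotor_config G \<rho>" "v \<in> verts G"
  shows "head G (\<rho> v) \<in> verts G" "head G (\<rho> v) \<noteq> v"
  using assms no_loops[of "\<rho> v"] by (auto simp: rotor_config_def)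

lemma charged_route:
  assumes "charged G S c" "rotor_config G (snd c)" "v \<in> verts G" "0 < fst c v"
  shows "charged G (insert v S) (route G nxt v c)"
proof -
  let ?c = "route G nxt v c"
  let ?w = "head G (snd ?c v)"
  have w: "?w \<noteq> v" "?w = head G (nxt (snd c v))"
    using rotor_config_head(2)[OF rotor_config_route[OF assms(2,3)] assms(3)]
    by (simp_all add: snd_route)
  have "\<exists>u \<in> C. 0 < fst ?c u" if C: "C \<subseteq> insert v S" "rotor_closed G (snd ?c) C" for C
  proof (cases "v \<in> C")
    \<comment> \<open>The head \<open>?w\<close> of the new rotor belongs to \<open>C\<close> and
      differs from \<open>v\<close>, so it lies in \<open>S\<close>; being nonnegative before, it is
      positive after receiving the chip.\<close>
    case True
    then have "?w \<in> C" using C by (auto simp: rotor_closed_def)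
    moreover from this have "0 \<le> fst c ?w"
      using w C assms(1) by (auto simp: charged_def)
    then have "0 < fst ?c ?w" using w by (simp add: fst_route)
    ultimately show ?thesis by blast
  next
    \<comment> \<open>Away from \<open>v\<close> no rotor changes and no chip is lost.\<close>
    case False
    then have "C \<subseteq> S" "rotor_closed G (snd c) C"
      using C by (auto simp: rotor_closed_def snd_route split: if_splits)
    then obtain u where "u \<in> C" "0 < fst c u"
      using assms(1) by (auto simp: charged_def)
    then show ?thesis using False by (intro bexI[of _ u]) (auto simp: fst_route)
  qed
  moreover have "\<forall>u \<in> insert v S. 0 \<le> fst ?c u"
    using assms by (auto simp: charged_def fst_route)
  ultimately show ?thesis by (auto simp: charged_def)
qed

lemma charged_legal_game:
  "legal_game G nxt vs c c' \<Longrightarrow> charged G S c \<Longrightarrow> rotor_config G (snd c) \<Longrightarrow>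
    charged G (S \<union> set vs) c'"
proof (induction vs arbitrary: S c)
  case (Cons v vs)
  then have "charged G (insert v S \<union> set vs) c'"
    by (intro Cons.IH[of "route G nxt v c"] charged_route rotor_config_route) simp_all
  then show ?case by simp
qed simp

section \<open>Recurrent configurations are charged\<close>

text \<open>If \<open>v\<close> is routed, its rotor returns only after full turns, so every arc
  leaving \<open>v\<close> carries a chip. An unrouted out-neighbour would end with more chips than
  it had, which a loop excludes; strong connectivity spreads this to all vertices.\<close>

lemma legal_loop_routes_all:
  assumes "strongly_connected G" "rotor_config G (snd c)"
    "legal_game G nxt vs c c" "vs \<noteq> []"
  shows "verts G \<subseteq> set vs"
proof
  have routed_verts: "set vs' \<subseteq> verts G" if "legal_game G nxt vs' d d'" for vs' d d'
    using that
  proof (induction vs' arbitrary: d)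
    case (Cons v vs')
    then have "set vs' \<subseteq> verts G" by (meson legal_game.simps(2))
    with Cons.prems show ?case by simp
  qed simp
  obtain u where u: "u \<in> set vs" using assms(4) by (cases vs) auto
  fix w assume "w \<in> verts G"
  then have "u \<rightarrow>\<^sup>*\<^bsub>G\<^esub> w"
    using assms(1) u routed_verts[OF assms(3)] by (auto simp: strongly_connected_def)
  then show "w \<in> set vs"
  proof (induction rule: reachable_induct)
    case base
    then show ?case using u by simp
  next
    case (step v w)
    then obtain e where e: "e \<in> arcs G" "tail G e = v" "head G e = w"
      by (auto simp: arcs_ends_conv)
    have v: "v \<in> verts G" using e by auto
    let ?k = "count_list vs v"
    have "(nxt ^^ ?k) (snd c v) = snd c v"
      using snd_legal_game[OF assms(3)] by metis
    moreover have "0 < ?k" using step by (simp add: count_list_0_iff zero_less_iff_neq_zero)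
    moreover have "e \<in> orbit nxt (snd c v)"
    proof -
      have "snd c v \<in> out_arcs G v" using assms(2) v by (simp add: rotor_config_def)
      then have "orbit nxt (snd c v) = out_arcs G v"
        using cyclic_out_arcs[OF v] by (metis cyclic_on_alldef empty_iff)
      then show ?thesis using e by simp
    qed
    ultimately obtain i where "0 < i" "i \<le> ?k" "e = (nxt ^^ i) (snd c v)"
      by (rule orbit_in_period)
    then show ?case
      using unrouted_chips_less[OF assms(3), of w i v] e by auto
  qed
qed

lemma charged_if_recurrent:
  assumes "strongly_connected G" "rotor_config G (snd c)" "recurrent G nxt c"
  shows "charged G (verts G) c"
proof -
  obtain vs where vs: "vs \<noteq> []" "legal_game G nxt vs c c"
    using assms(3) by (auto simp: recurrent_iff_legal_game)
  \<comment> \<open>The invariant is vacuous for the empty set; one passage around the loop extends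
    it to all vertices.\<close>
  have "charged G {} c" by (auto simp: charged_def rotor_closed_def)
  then have "charged G (set vs) c"
    using charged_legal_game[OF vs(2)] assms(2) by fastforce
  with legal_loop_routes_all[OF assms(1,2) vs(2,1)] show ?thesis
    unfolding charged_def by (meson subset_iff)
qed

section \<open>Commuting routings and preservation of recurrence\<close>

lemma route_commute:
  assumes "u \<noteq> v"
  shows "route G nxt u (route G nxt v c) = route G nxt v (route G nxt u c)"
  using assms by (auto simp: prod_eq_iff fun_eq_iff fst_route snd_route)

text \<open>Routing at \<open>v\<close> first takes a chip only from \<open>v\<close>, which the
  game does not route, so every routing of the game stays legal; \<open>v\<close> in turn keeps its
  chip throughout the game.\<close>

lemma legal_game_swap:
  assumes "legal_game G nxt vs c d" "v \<notin> set vs" "v \<in> verts G" "0 < fst c v"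
  shows "legal_game G nxt vs (route G nxt v c) (route G nxt v d)"
  using assms
proof (induction vs arbitrary: c)
  case (Cons u vs)
  then have "legal_game G nxt vs (route G nxt v (route G nxt u c)) (route G nxt v d)"
    by (intro Cons.IH) (auto simp: fst_route)
  moreover have "route G nxt v (route G nxt u c) = route G nxt u (route G nxt v c)"
    using Cons.prems by (intro route_commute) auto
  moreover have "0 < fst (route G nxt v c) u"
    using Cons.prems by (auto simp: fst_route)
  ultimately show ?case using Cons.prems by simp
qed simp

text \<open>
  Every vertex is routed in a loop through \<open>c\<close>, so the first routing at \<open>v\<close> in that loop can be
  moved to its beginning, which yields a loop through the configuration after routing at \<open>v\<close>.
\<close>
lemma recurrent_route:
  assumes "strongly_connected G" "rotor_config G (snd c)" "recurrent G nxt c"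
    "v \<in> verts G" "0 < fst c v"
  shows "recurrent G nxt (route G nxt v c)"
proof -
  obtain vs where vs: "vs \<noteq> []" "legal_game G nxt vs c c"
    using assms(3) by (auto simp: recurrent_iff_legal_game)
  then have "v \<in> set vs" using legal_loop_routes_all assms by blast
  then obtain as bs where split: "vs = as @ v # bs" "v \<notin> set as"
    by (meson split_list_first)
  obtain d where d: "legal_game G nxt as c d" "legal_game G nxt bs (route G nxt v d) c"
    using vs(2) by (auto simp: split(1) legal_game_append)
  have "legal_game G nxt as (route G nxt v c) (route G nxt v d)"
    using legal_game_swap d(1) split(2) assms(4,5) by blast
  then have "legal_game G nxt (as @ bs @ [v]) (route G nxt v c) (route G nxt v c)"
    using d(2) assms(4,5) unfolding legal_game_append
    by (metis legal_game.simps)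
  then show ?thesis unfolding recurrent_iff_legal_game by blast
qed

lemma recurrent_legal_game:
  "legal_game G nxt vs c d \<Longrightarrow> strongly_connected G \<Longrightarrow> rotor_config G (snd c) \<Longrightarrow>
    recurrent G nxt c \<Longrightarrow> recurrent G nxt d"
proof (induction vs arbitrary: c)
  case (Cons v vs)
  then show ?case
    by (intro Cons.IH[of "route G nxt v c"] recurrent_route rotor_config_route) simp_all
qed simp

section \<open>Backward routing and recurrence of charged configurations\<close>

text \<open>
  A chip can be routed backwards inside a minimal closed set \<open>M\<close>: any other closed set that
  avoids the new position of the chip is disjoint from \<open>M\<close>, so it keeps all its chips.
\<close>
lemma charged_predecessor:
  assumes "verts G \<noteq> {}" "rotor_config G (snd c)" "charged G (verts G) c"
  obtains v d where "v \<in> verts G" "0 < fst d v" "route G nxt v d = c"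
    "rotor_config G (snd d)" "charged G (verts G) d"
proof -
  obtain x \<rho> where c: "c = (x, \<rho>)" by fastforce
  define A where "A = {C \<in> Pow (verts G). rotor_closed G \<rho> C}"
  have rc: "rotor_config G \<rho>" using assms(2) c by simp
  have "verts G \<in> A"
    using assms(1) rotor_config_head[OF rc] by (auto simp: A_def rotor_closed_def)
  moreover have "finite A" by (simp add: A_def)
  ultimately obtain M where "M \<in> A" and M_min: "\<And>C. C \<in> A \<Longrightarrow> C \<subseteq> M \<Longrightarrow> C = M"
    using finite_has_minimal[of A] by blast
  then have M: "M \<subseteq> verts G" "rotor_closed G \<rho> M" by (auto simp: A_def)
  obtain w where w: "w \<in> M" "0 < x w"
    using M assms(3) c by (auto simp: charged_def)
  \<comment> \<open>The image of \<open>M\<close> under the rotor map is again closed, so minimality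
    forces equality; hence some rotor in \<open>M\<close> points to \<open>w\<close>.\<close>
  have "(\<lambda>v. head G (\<rho> v)) ` M = M"
    using M by (intro M_min) (auto simp: A_def rotor_closed_def)
  with w(1) have "w \<in> (\<lambda>v. head G (\<rho> v)) ` M" by (simp only:)
  then obtain v where v: "v \<in> M" "head G (\<rho> v) = w" by blast
  have vV: "v \<in> verts G" using M v by auto
  have vw: "v \<noteq> w" using rotor_config_head[OF rc vV] v by auto
  obtain e where e: "e \<in> out_arcs G v" "nxt e = \<rho> v"
    using ex_prev_arc[OF vV, of "\<rho> v"] rc vV by (auto simp: rotor_config_def)
  define y where "y u = x u + of_bool (u = v) - of_bool (u = w)" for u
  let ?d = "(y, \<rho>(v := e))"
  have x_nonneg: "\<forall>u \<in> verts G. 0 \<le> x u" using assms(3) c by (simp add: charged_def)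
  have "0 < y v" using x_nonneg vV vw by (auto simp: y_def)
  moreover have "route G nxt v ?d = c"
    using e v by (auto simp: c y_def prod_eq_iff fun_eq_iff fst_route snd_route)
  moreover have "rotor_config G (snd ?d)" using rc e by (auto simp: rotor_config_def)
  moreover have "charged G (verts G) ?d"
  proof -
    have "\<exists>u \<in> C. 0 < y u" if C: "C \<subseteq> verts G" "rotor_closed G (\<rho>(v := e)) C" for C
    proof (cases "v \<in> C")
      case True
      with \<open>0 < y v\<close> show ?thesis by blast
    next
      case False
      then have closed: "rotor_closed G \<rho> C"
        using C by (auto simp: rotor_closed_def split: if_splits)
      have "w \<notin> C"
      proof
        assume "w \<in> C"
        then have "M \<inter> C \<in> A"
          using M closed w by (auto simp: A_def rotor_closed_def)
        then have "M \<inter> C = M" using M_min by blast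
        then show False using False v by blast
      qed
      moreover obtain u where "u \<in> C" "0 < x u"
        using closed C assms(3) c by (auto simp: charged_def)
      ultimately show ?thesis by (intro bexI[of _ u]) (auto simp: y_def)
    qed
    moreover have "\<forall>u \<in> verts G. 0 \<le> y u"
      using x_nonneg w by (auto simp: y_def)
    ultimately show ?thesis by (simp add: charged_def)
  qed
  ultimately show thesis using that[of v ?d] vV by simp
qed

lemma sum_chips_route:
  assumes "rotor_config G (snd c)" "v \<in> verts G"
  shows "(\<Sum>u \<in> verts G. fst (route G nxt v c) u) = (\<Sum>u \<in> verts G. fst c u)"
proof -
  have "head G (nxt (snd c v)) \<in> verts G"
    using assms nxt_out_arcs by (auto simp: rotor_config_def)
  then show ?thesis
    using assms(2) by (simp add: fst_route sum.distrib sum_subtractf of_bool_def sum.delta)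
qed

lemma recurrent_if_charged:
  assumes "strongly_connected G" "rotor_config G (snd c)" "charged G (verts G) c"
  shows "recurrent G nxt c"
proof -
  define n where "n = (\<Sum>u \<in> verts G. fst c u)"
  \<comment> \<open>With \<open>n\<close> chips in total and none negative, each vertex carries
    between 0 and \<open>n\<close>; agreement with \<open>c\<close> elsewhere then makes
    \<open>A\<close> finite.\<close>
  define A where "A = {d. rotor_config G (snd d) \<and> charged G (verts G) d \<and>
    (\<Sum>u \<in> verts G. fst d u) = n \<and> (\<forall>u. u \<notin> verts G \<longrightarrow> fst d u = fst c u \<and> snd d u = snd c u)}"
  have "finite A"
  proof (rule finite_subset)
    let ?X = "{x. (\<forall>u \<in> verts G. x u \<in> {0..n}) \<and> (\<forall>u. u \<notin> verts G \<longrightarrow> x u = fst c u)}"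
    let ?R = "{\<rho>. (\<forall>u \<in> verts G. \<rho> u \<in> out_arcs G u) \<and> (\<forall>u. u \<notin> verts G \<longrightarrow> \<rho> u = snd c u)}"
    have nonneg: "0 \<le> fst d u" if "d \<in> A" "u \<in> verts G" for d u
      using that by (simp add: A_def charged_def)
    have "fst d u \<le> n" if "d \<in> A" "u \<in> verts G" for d u
    proof -
      have "fst d u \<le> (\<Sum>u \<in> verts G. fst d u)"
        using that nonneg by (intro member_le_sum) simp_all
      then show ?thesis using that(1) by (simp add: A_def)
    qed
    with nonneg have "fst d \<in> ?X \<and> snd d \<in> ?R" if "d \<in> A" for d
      using that by (simp add: A_def rotor_config_def)
    then show "A \<subseteq> ?X \<times> ?R" by (simp add: subset_iff mem_Times_iff)
    show "finite (?X \<times> ?R)"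
      by (intro finite_cartesian_product finite_functions_fixed_outside) auto
  qed
  have "\<exists>d v. d \<in> A \<and> v \<in> verts G \<and> 0 < fst d v \<and> route G nxt v d = e"
    if e: "e \<in> A" for e
  proof -
    obtain v d where vd: "v \<in> verts G" "0 < fst d v" "route G nxt v d = e"
      "rotor_config G (snd d)" "charged G (verts G) d"
    proof (rule charged_predecessor)
      show "verts G \<noteq> {}" using assms(1) by (simp add: strongly_connected_def)
      show "rotor_config G (snd e)" "charged G (verts G) e" using e by (simp_all add: A_def)
    qed
    have "fst d u = fst e u \<and> snd d u = snd e u" if "u \<notin> verts G" for u
    proof -
      have "u \<noteq> v" "u \<noteq> head G (snd e v)"
        using that vd(1) rotor_config_head[OF rotor_config_route[OF vd(4,1)] vd(1)] vd(3) by auto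
      then show ?thesis using vd(3) by (auto simp: fst_route snd_route)
    qed
    with e have "d \<in> A" using vd sum_chips_route[OF vd(4,1)] by (auto simp: A_def)
    with vd show ?thesis by blast
  qed
  then obtain pred where pred: "pred e \<in> A"
    "\<exists>v. v \<in> verts G \<and> 0 < fst (pred e) v \<and> route G nxt v (pred e) = e" if "e \<in> A" for e
    by metis
  have c: "c \<in> A" using assms by (simp add: A_def n_def)
  \<comment> \<open>The length is recorded so that a period \<open>k > 0\<close> of
    \<open>pred\<close> yields a nonempty game.\<close>
  have game: "(pred ^^ k) e \<in> A \<and> (\<exists>vs. length vs = k \<and> legal_game G nxt vs ((pred ^^ k) e) e)"
    if "e \<in> A" for e k
  proof (induction k)
    case (Suc k)
    then obtain vs where vs: "length vs = k" "legal_game G nxt vs ((pred ^^ k) e) e" by blast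
    obtain v where v: "v \<in> verts G" "0 < fst (pred ((pred ^^ k) e)) v"
        "route G nxt v (pred ((pred ^^ k) e)) = (pred ^^ k) e"
      using pred(2) Suc by blast
    have "legal_game G nxt (v # vs) ((pred ^^ Suc k) e) e"
      using vs v by simp
    moreover have "length (v # vs) = Suc k" using vs by simp
    ultimately show ?case using pred(1) Suc by (metis funpow.simps(2) o_apply)
  qed (use that in auto)
  \<comment> \<open>Going back \<open>m\<close> steps from \<open>c\<close> reaches a periodic point
    of \<open>pred\<close>: its period is a legal loop, and the \<open>m\<close> steps read forwards
    are a game ending in \<open>c\<close>.\<close>
  obtain m k where mk: "0 < k" "(pred ^^ k) ((pred ^^ m) c) = (pred ^^ m) c"
    using finite_funpow_periodic[OF \<open>finite A\<close> _ c, of pred] pred(1) by blast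
  let ?d = "(pred ^^ m) c"
  have d: "?d \<in> A" and "\<exists>vs. legal_game G nxt vs ?d c" using game[OF c] by blast+
  moreover have "recurrent G nxt ?d"
    using game[OF d, of k] mk by (force simp: recurrent_iff_legal_game)
  moreover have "rotor_config G (snd ?d)" using d by (simp add: A_def)
  ultimately show ?thesis
    using recurrent_legal_game assms(1) by blast
qed

section \<open>Rotor-closed sets and cycles of the rotor subgraph\<close>

text \<open>An arc of the rotor subgraph is the rotor of its tail, so from a vertex of the cycle the
  rotor follows the cycle.\<close>

lemma rotor_subgraph_cycle_closed:
  assumes "rotor_config G \<rho>" "pre_digraph.cycle (rotor_subgraph G \<rho>) p"
  shows "tail G ` set p \<subseteq> verts G" "rotor_closed G \<rho> (tail G ` set p)"
proof -
  let ?R = "rotor_subgraph G \<rho>"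
  have R: "verts ?R = verts G" "arcs ?R = \<rho> ` verts G" "tail ?R = tail G" "head ?R = head G"
    by (simp_all add: rotor_subgraph_def)
  obtain u where u: "pre_digraph.cas ?R u p u" "set p \<subseteq> \<rho> ` verts G" "p \<noteq> []"
    using assms(2) by (auto simp: pre_digraph.cycle_def pre_digraph.awalk_def R)
  have arc: "e = \<rho> (tail G e) \<and> tail G e \<in> verts G" if "e \<in> set p" for e
    using that u(2) assms(1) by (auto simp: rotor_config_def)
  then show "tail G ` set p \<subseteq> verts G" by auto
  have "u \<in> tail G ` set p"
    using u by (cases p) (auto simp: pre_digraph.cas.simps R)
  then have "head G e \<in> tail G ` set p" if "e \<in> set p" for e
    using pre_digraph.cas_head_in[OF u(1) that] by (auto simp: R)
  then show "rotor_closed G \<rho> (tail G ` set p)"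
    using u(3) arc by (auto simp: rotor_closed_def)
qed

text \<open>Following rotors inside the finite set \<open>C\<close> eventually repeats a vertex; the
  resulting closed walk contains a cycle.\<close>

lemma rotor_closed_imp_cycle:
  assumes "rotor_config G \<rho>" "C \<subseteq> verts G" "rotor_closed G \<rho> C"
  obtains p where "pre_digraph.cycle (rotor_subgraph G \<rho>) p" "tail G ` set p \<subseteq> C"
proof -
  let ?R = "rotor_subgraph G \<rho>"
  \<comment> \<open>Extracting the cycle in the restriction to \<open>C\<close> keeps its vertices
    in \<open>C\<close>; it is transferred to the whole rotor subgraph afterwards.\<close>
  define H where "H = G\<lparr>verts := C, arcs := \<rho> ` C\<rparr>"
  have H: "verts H = C" "arcs H = \<rho> ` C" "tail H = tail G" "head H = head G"
    by (simp_all add: H_def)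
  define f where "f v = head G (\<rho> v)" for v
  have tail_rotor: "tail G (\<rho> v) = v" if "v \<in> C" for v
    using that assms(1,2) by (auto simp: rotor_config_def)
  have f_in: "f v \<in> C" if "v \<in> C" for v
    using that assms(3) by (auto simp: rotor_closed_def f_def)
  interpret H: wf_digraph H
    using f_in tail_rotor by unfold_locales (auto simp: H f_def)
  interpret R: wf_digraph ?R
    using rotor_config_head[OF assms(1)] assms(1)
    by unfold_locales (auto simp: rotor_subgraph_def rotor_config_def)
  have walk: "H.awalk v (map (\<lambda>i. \<rho> ((f ^^ i) v)) [0..<n]) ((f ^^ n) v)
      \<and> (f ^^ n) v \<in> C" if "v \<in> C" for v n
  proof (induction n)
    case 0
    then show ?case using that by (simp add: H.awalk_def H)
  next
    case (Suc n)
    let ?v = "(f ^^ n) v"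
    have "H.awalk ?v [\<rho> ?v] (f ?v)"
      using Suc tail_rotor by (simp add: H.awalk_def H f_def[of ?v])
    then show ?case using Suc f_in by (auto intro: H.awalk_appendI)
  qed
  obtain u where "u \<in> C" using assms(3) by (auto simp: rotor_closed_def)
  then obtain m n where mn: "0 < n" "(f ^^ n) ((f ^^ m) u) = (f ^^ m) u"
    using finite_funpow_periodic[of C f u] f_in finite_subset[OF assms(2)]
    by (metis finite_verts image_subsetI)
  have "(f ^^ m) u \<in> C" using walk \<open>u \<in> C\<close> by blast
  from walk[OF this, of n] mn have "H.closed_w (map (\<lambda>i. \<rho> ((f ^^ i) ((f ^^ m) u))) [0..<n])"
    by (auto simp: H.closed_w_def)
  then obtain p where p: "H.cycle p" using H.closed_w_imp_cycle by blast
  have "subgraph H ?R"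
    using assms(2) H.wf_digraph R.wf_digraph
    by (auto simp: subgraph_def compatible_def H rotor_subgraph_def)
  then have "R.cycle p" using p by (rule R.subgraph_cycle)
  moreover have "set p \<subseteq> \<rho> ` C"
    using p by (auto simp: H.cycle_def H.awalk_def H)
  then have "tail G ` set p \<subseteq> C" using tail_rotor by auto
  ultimately show thesis using that by blast
qed

lemma charged_iff_cycles:
  assumes "rotor_config G \<rho>"
  shows "charged G (verts G) (x, \<rho>) \<longleftrightarrow>
    (\<forall>v \<in> verts G. x v \<ge> 0) \<and>
    (\<forall>p. pre_digraph.cycle (rotor_subgraph G \<rho>) p \<longrightarrow> (\<exists>v \<in> tail G ` set p. x v > 0))"
    (is "_ \<longleftrightarrow> ?nonneg \<and> ?cycles")
proof -
  have "?cycles \<longleftrightarrow> (\<forall>C \<subseteq> verts G. rotor_closed G \<rho> C \<longrightarrow> (\<exists>v \<in> C. 0 < x v))"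
  proof (intro iffI allI impI)
    fix C assume "?cycles" "C \<subseteq> verts G" "rotor_closed G \<rho> C"
    then obtain p where "pre_digraph.cycle (rotor_subgraph G \<rho>) p" "tail G ` set p \<subseteq> C"
      using rotor_closed_imp_cycle[OF assms] by blast
    with \<open>?cycles\<close> show "\<exists>v \<in> C. 0 < x v" by fast
  next
    fix p assume "\<forall>C \<subseteq> verts G. rotor_closed G \<rho> C \<longrightarrow> (\<exists>v \<in> C. 0 < x v)"
      "pre_digraph.cycle (rotor_subgraph G \<rho>) p"
    then show "\<exists>v \<in> tail G ` set p. x v > 0"
      using rotor_subgraph_cycle_closed[OF assms] by blast
  qed
  then show ?thesis by (simp add: charged_def)
qed

end

theorem theorem2p4:
  fixes G :: "('a, 'b) pre_digraph" and nxt :: "'b \<Rightarrow> 'b"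
    and x :: "'a divisor" and \<rho> :: "'a \<Rightarrow> 'b"
  assumes "ribbon_digraph G nxt"
    and "strongly_connected G"
    and "rotor_config G \<rho>"
  shows "recurrent G nxt (x, \<rho>) \<longleftrightarrow>
    (\<forall>v \<in> verts G. x v \<ge> 0) \<and>
    (\<forall>p. pre_digraph.cycle (rotor_subgraph G \<rho>) p \<longrightarrow> (\<exists>v \<in> tail G ` set p. x v > 0))"
proof -
  interpret ribbon_digraph G nxt by fact
  have "recurrent G nxt (x, \<rho>) \<longleftrightarrow> charged G (verts G) (x, \<rho>)"
    using charged_if_recurrent[OF assms(2)] recurrent_if_charged[OF assms(2)] assms(3) by auto
  then show ?thesis using charged_iff_cycles[OF assms(3)] by simp
qed

end
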